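(* Let $U\in\mathbb{R}^{N\times P}$ be the matrix of true snapshots and $U_0\in\mathbb{R}^{N\times P}$ the matrix of background snapshots of the plasma wave equation described in the context, let $W$ be the diagonal matrix of spatial quadrature weights, let $M=UWU^\top=LL^\top$ and $M_0=U_0WU_0^\top=L_0L_0^\top$ be the mass matrices with their Cholesky decompositions ($L,L_0$ lower triangular with positive diagonal entries), and let $\mathbf{U}=LL_0^{-1}U_0$ be the data generated family. Let $\widehat{U}$ be the best admissible approximation to the true snapshots (defined in the context), and let $\widehat{M}=\widehat{U}W\widehat{U}^\top$ be its mass matrix. Then for $$\epsilon'=\kappa_2(M)\,\frac{\|M-\widehat{M}\|_F}{\|M\|_2},\qquad \kappa_2(M)=\|M\|_2\,\|M^{-1}\|_2,$$ small enough, $$\|\mathbf{U}-\widehat{U}\|_2\le\epsilon'\,\|U\|_2,$$ where the norms of the snapshot families $\mathbf{U}-\widehat{U}$ and $U$ are the stacked norm defined in the context. That is, the data generated internal solutions are within relative distance $\epsilon'$, in the stacked norm, of the best causal approximation of the true solutions from the background snapshot family.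
   Context: Let $\Omega\subset\mathbb{R}^d$, $d=1$ or $2$, be a bounded domain. For $m=1,\dots,n_b$, let $u_m$ solve the plasma wave equation $u_{tt}-\Delta u+q(x)u=0$ in $\Omega$ for $0<t<T$, with homogeneous Neumann condition $\partial u/\partial\nu=0$ on $\partial\Omega$ and initial conditions $u(x,0)=g_m(x)$, $u_t(x,0)=0$. Here $q$ is the unknown potential and the $g_m$ are source profiles localized near the boundary. Let $u^0_m$ be the corresponding solutions with $q$ replaced by the known background potential $q_0=0$. Snapshots are taken at $n_t$ sample times $j\tau$, and $N=n_tn_b$. The rows of $U\in\mathbb{R}^{N\times P}$ are the true snapshots $u_m(\cdot,j\tau)$ sampled on a spatial grid with $P$ points, and the rows of $U_0\in\mathbb{R}^{N\times P}$ are the corresponding background snapshots $u^0_m(\cdot,j\tau)$. In both, rows are indexed $0,\dots,N-1$ in time-major order (time index slow, source index fast). $W\in\mathbb{R}^{P\times P}$ is the diagonal matrix of spatial quadrature weights. Both snapshot families are assumed linearly independent, so that $M$ and $M_0$ are symmetric positive definite. Stacked norm: for a snapshot family $V\in\mathbb{R}^{N\times P}$ with rows $v_0,\dots,v_{N-1}$, $$\|V\|_2=\left(\operatorname{trace}(VWV^\top)\right)^{1/2}=\Big(\sum_{i=0}^{N-1}\|v_i\|_{L^2(\Omega)}^2\Big)^{1/2},$$ where $L^2(\Omega)$ norms and inner products of grid functions are the discrete ones induced by $W$, $\langle v,w\rangle=vWw^\top$. For the $N\times N$ matrices $M$, $M^{-1}$, $\|\cdot\|_2$ is the spectral norm; $\|\cdot\|_F$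 is the Frobenius norm. Admissible: $B\in\mathbb{R}^{N\times P}$ is admissible if $B=SU_0$ for some lower triangular $S\in\mathbb{R}^{N\times N}$ with positive diagonal entries. Best admissible approximation: for each $i$, let $P_i$ be the $W$-weighted $L^2(\Omega)$ orthogonal projection onto $\operatorname{span}\{(U_0)_0,\dots,(U_0)_i\}$, the span of rows $0,\dots,i$ of $U_0$. The sequential causal projections of the true snapshots are $\widehat{U}_i=P_iU_i$, $i=0,\dots,N-1$, where $U_i$ is row $i$ of $U$; they form the rows of $\widehat{U}=\widehat{S}U_0$ with $\widehat{S}$ lower triangular. If the diagonal entries of $\widehat{S}$ are positive, then $\widehat{U}$ is admissible and minimizes $\|U-B\|_2$ over admissible $B$; only in this case is $\widehat{U}$ called the best admissible approximation to $U$, so this positivity is part of the hypothesis that $\widehat{U}$ is the best admissible approximation. *)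

theory Defs
  imports
    "HOL-Analysis.Analysis"
    "Jordan_Normal_Form.VS_Connect"
    "Jordan_Normal_Form.Gauss_Jordan_Elimination"
begin

no_notation scalar_prod (infix \<open>\<bullet>\<close> 70)

text \<open>
  First-order (blow-up) form of the outward unit normal: near \<open>x\<close> the set \<open>\<Omega>\<close> looks like the half
  space \<open>{y. (y - x) \<bullet> \<nu> < 0}\<close>. At a boundary point such a \<open>\<nu>\<close> is unique if it exists; it is the
  usual normal of a \<open>C\<^sup>1\<close> boundary, and there is none at, say, the corners of a rectangle.
\<close>

definition outward_unit_normal :: "'a::euclidean_space set \<Rightarrow> 'a \<Rightarrow> 'a \<Rightarrow> bool" where
  "outward_unit_normal \<Omega> x \<nu> \<longleftrightarrow>
     norm \<nu> = 1 \<and>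
     (\<forall>\<epsilon>>0. \<exists>r>0. \<forall>y\<in>ball x r.
        ((y - x) \<bullet> \<nu> < - \<epsilon> * norm (y - x) \<longrightarrow> y \<in> \<Omega>) \<and>
        ((y - x) \<bullet> \<nu> > \<epsilon> * norm (y - x) \<longrightarrow> y \<notin> \<Omega>))"

text \<open>One-sided derivative along \<open>\<nu>\<close>, taken from inside the domain.\<close>

definition has_normal_derivative :: "('a::euclidean_space \<Rightarrow> real) \<Rightarrow> 'a \<Rightarrow> 'a \<Rightarrow> real \<Rightarrow> bool" where
  "has_normal_derivative f x \<nu> d \<longleftrightarrow>
     ((\<lambda>h. f (x + h *\<^sub>R \<nu>)) has_real_derivative d) (at_left 0)"

text \<open>
  Laplacian as the trace of the Hessian: \<open>G\<close> is the gradient of \<open>f\<close> near \<open>x\<close>, and \<open>H\<close> is the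
  derivative of \<open>G\<close> at \<open>x\<close>.
\<close>

definition has_laplacian :: "('a::euclidean_space \<Rightarrow> real) \<Rightarrow> 'a \<Rightarrow> real \<Rightarrow> bool" where
  "has_laplacian f x l \<longleftrightarrow>
     (\<exists>G H. (\<forall>\<^sub>F y in nhds x. GDERIV f y :> G y) \<and> (G has_derivative H) (at x) \<and>
            l = (\<Sum>b\<in>Basis. H b \<bullet> b))"

text \<open>
  Classical solutions: continuous up to the boundary, with the derivatives in the equation existing
  pointwise in the interior. The Neumann condition is imposed at every boundary point that has an
  outward unit normal.
\<close>

definition plasma_wave_solution ::
  "'a::euclidean_space set \<Rightarrow> real \<Rightarrow> ('a \<Rightarrow> real) \<Rightarrow> ('a \<Rightarrow> real) \<Rightarrow> (real \<Rightarrow> 'a \<Rightarrow> real) \<Rightarrow> bool" where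
  "plasma_wave_solution \<Omega> T q g u \<longleftrightarrow>
     continuous_on ({0..T} \<times> closure \<Omega>) (\<lambda>(t, x). u t x) \<and>
     (\<exists>u\<^sub>t u\<^sub>t\<^sub>t lap. \<forall>t\<in>{0<..<T}. \<forall>x\<in>\<Omega>.
        ((\<lambda>s. u s x) has_real_derivative u\<^sub>t t x) (at t) \<and>
        ((\<lambda>s. u\<^sub>t s x) has_real_derivative u\<^sub>t\<^sub>t t x) (at t) \<and>
        has_laplacian (u t) x (lap t x) \<and>
        u\<^sub>t\<^sub>t t x - lap t x + q x * u t x = 0) \<and>
     (\<forall>t\<in>{0<..<T}. \<forall>x\<in>frontier \<Omega>. \<forall>\<nu>.
        outward_unit_normal \<Omega> x \<nu> \<longrightarrow> has_normal_derivative (u t) x \<nu> 0) \<and>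
     (\<forall>x\<in>\<Omega>. u 0 x = g x \<and> ((\<lambda>s. u s x) has_real_derivative 0) (at_right 0))"

text \<open>
  Sources are numbered \<open>1, \<dots>, n\<^sub>b\<close> and times \<open>0, \<tau>, \<dots>, (n\<^sub>t - 1) \<tau>\<close>; row \<open>j * n\<^sub>b + (m - 1)\<close> holds
  source \<open>m\<close> at time \<open>j \<tau>\<close>.
\<close>

definition snapshot_matrix ::
  "nat \<Rightarrow> nat \<Rightarrow> real \<Rightarrow> nat \<Rightarrow> (nat \<Rightarrow> 'a) \<Rightarrow> (nat \<Rightarrow> real \<Rightarrow> 'a \<Rightarrow> real) \<Rightarrow> real mat" where
  "snapshot_matrix n\<^sub>t n\<^sub>b \<tau> P \<xi> u =
     mat (n\<^sub>t * n\<^sub>b) P (\<lambda>(i, k). u (i mod n\<^sub>b + 1) (real (i div n\<^sub>b) * \<tau>) (\<xi> k))"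

definition mat_trace :: "real mat \<Rightarrow> real" where
  "mat_trace A = (\<Sum>i<dim_row A. A $$ (i, i))"

definition stacked_norm :: "real mat \<Rightarrow> real mat \<Rightarrow> real" where
  "stacked_norm W V = sqrt (mat_trace (V * W * V\<^sup>T))"

definition frobenius_norm :: "real mat \<Rightarrow> real" where
  "frobenius_norm A = sqrt (\<Sum>i<dim_row A. \<Sum>j<dim_col A. (A $$ (i, j))\<^sup>2)"

definition euclid_norm :: "real vec \<Rightarrow> real" where
  "euclid_norm v = sqrt (scalar_prod v v)"

definition spectral_norm :: "real mat \<Rightarrow> real" where
  "spectral_norm A =
     (SUP v\<in>{v \<in> carrier_vec (dim_col A). euclid_norm v = 1}. euclid_norm (A *\<^sub>v v))"

text \<open>Only meaningful for invertible square matrices, since \<^const>\<open>mat_inverse\<close> is partial.\<close>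

definition mat_inv :: "real mat \<Rightarrow> real mat" where
  "mat_inv A = the (mat_inverse A)"

definition cond_number :: "real mat \<Rightarrow> real" where
  "cond_number A = spectral_norm A * spectral_norm (mat_inv A)"

definition lower_triangular_pos :: "nat \<Rightarrow> real mat \<Rightarrow> bool" where
  "lower_triangular_pos n A \<longleftrightarrow>
     A \<in> carrier_mat n n \<and>
     (\<forall>i<n. \<forall>j<n. i < j \<longrightarrow> A $$ (i, j) = 0) \<and> (\<forall>i<n. A $$ (i, i) > 0)"

definition cholesky :: "real mat \<Rightarrow> real mat \<Rightarrow> bool" where
  "cholesky A L \<longleftrightarrow> lower_triangular_pos (dim_row A) L \<and> A = L * L\<^sup>T"

text \<open>Distinctness is needed because \<^const>\<open>set\<close> would forget repeated rows.\<close>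

definition rows_lin_indpt :: "real mat \<Rightarrow> bool" where
  "rows_lin_indpt A \<longleftrightarrow>
     distinct (rows A) \<and>
     \<not> LinearCombinations.module.lin_dep class_ring (module_vec TYPE(real) (dim_col A)) (set (rows A))"

definition admissible :: "real mat \<Rightarrow> real mat \<Rightarrow> bool" where
  "admissible U\<^sub>0 B \<longleftrightarrow> (\<exists>S. lower_triangular_pos (dim_row U\<^sub>0) S \<and> B = S * U\<^sub>0)"

definition W_inner :: "real mat \<Rightarrow> real vec \<Rightarrow> real vec \<Rightarrow> real" where
  "W_inner W v w = scalar_prod v (W *\<^sub>v w)"

definition causal_span :: "real mat \<Rightarrow> nat \<Rightarrow> real vec set" where
  "causal_span U\<^sub>0 i =
     LinearCombinations.module.span class_ring (module_vec TYPE(real) (dim_col U\<^sub>0)) (row U\<^sub>0 ` {..i})"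

definition is_W_projection :: "real mat \<Rightarrow> real vec set \<Rightarrow> real vec \<Rightarrow> real vec \<Rightarrow> bool" where
  "is_W_projection W X v p \<longleftrightarrow> p \<in> X \<and> (\<forall>x\<in>X. W_inner W (v - p) x = 0)"

definition causal_projections :: "real mat \<Rightarrow> real mat \<Rightarrow> real mat \<Rightarrow> real mat \<Rightarrow> bool" where
  "causal_projections W U\<^sub>0 U Uhat \<longleftrightarrow>
     Uhat \<in> carrier_mat (dim_row U) (dim_col U) \<and>
     (\<forall>i<dim_row U. is_W_projection W (causal_span U\<^sub>0 i) (row U i) (row Uhat i))"

text \<open>
  For linearly independent rows of \<open>U\<^sub>0\<close> the matrix \<open>S\<close> with \<open>Uhat = S * U\<^sub>0\<close> is unique, so
  admissibility says exactly that its diagonal is positive.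
\<close>

definition best_admissible :: "real mat \<Rightarrow> real mat \<Rightarrow> real mat \<Rightarrow> real mat \<Rightarrow> bool" where
  "best_admissible W U\<^sub>0 U Uhat \<longleftrightarrow> causal_projections W U\<^sub>0 U Uhat \<and> admissible U\<^sub>0 Uhat"

end

theory Submission
  imports Defs
begin

unbundle no vec_syntax

text \<open>
  With \<open>Uhat = S * U\<^sub>0\<close>, the matrix \<open>K = S * L\<^sub>0\<close> is the Cholesky factor of \<open>Mhat\<close>, and since
  \<open>L\<^sub>0\<inverse> U\<^sub>0\<close> has \<open>W\<close>-orthonormal rows the claim becomes the perturbation bound
  \<open>\<parallel>L - K\<parallel>\<^sub>F \<le> \<epsilon>' \<parallel>L\<parallel>\<^sub>F\<close> for Cholesky factors. Put \<open>R = L\<inverse> K\<close> and \<open>E = R R\<^sup>T - 1\<close>; then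
  \<open>\<parallel>E\<parallel>\<^sub>F \<le> \<epsilon>'\<close>, and \<open>L - K = L (1 - R)\<close>, so it suffices to show \<open>\<parallel>R - 1\<parallel>\<^sub>F \<le> \<parallel>E\<parallel>\<^sub>F\<close>.
  With \<open>G = R - 1\<close> lower triangular, \<open>G + G\<^sup>T = E - G G\<^sup>T\<close> gives
  \<open>\<surd>2 \<parallel>G\<parallel>\<^sub>F \<le> \<parallel>E\<parallel>\<^sub>F + \<parallel>G\<parallel>\<^sub>F\<^sup>2\<close>. The large root of this quadratic inequality is excluded by
  \<open>R\<^sup>T - R\<inverse> = R\<inverse> E\<close>, whose left side dominates \<open>G\<^sup>T\<close> entrywise because \<open>R\<close> and \<open>R\<inverse>\<close> are both
  lower triangular. This yields \<open>\<delta> = 1/5\<close>, uniformly in all sizes.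
\<close>

section \<open>Frobenius norm and trace\<close>

lemma frobenius_norm_eq_L2_set:
  "A \<in> carrier_mat m n \<Longrightarrow> frobenius_norm A = L2_set (\<lambda>p. A $$ p) ({..<m} \<times> {..<n})"
  by (auto simp: frobenius_norm_def L2_set_def sum.cartesian_product)

lemma frobenius_norm_nonneg [simp]: "0 \<le> frobenius_norm A"
  by (auto simp: frobenius_norm_def intro!: sum_nonneg)

lemma frobenius_norm_power2:
  "A \<in> carrier_mat m n \<Longrightarrow> (frobenius_norm A)\<^sup>2 = (\<Sum>i<m. \<Sum>j<n. (A $$ (i, j))\<^sup>2)"
  by (auto simp: frobenius_norm_def intro!: sum_nonneg)

lemma frobenius_norm_triangle:
  assumes "A \<in> carrier_mat m n" "B \<in> carrier_mat m n"
  shows "frobenius_norm (A + B) \<le> frobenius_norm A + frobenius_norm B"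
proof -
  have "frobenius_norm (A + B) = L2_set (\<lambda>p. A $$ p + B $$ p) ({..<m} \<times> {..<n})"
    using assms by (subst frobenius_norm_eq_L2_set[of _ m n]) (auto intro!: L2_set_cong)
  then show ?thesis
    using assms by (simp add: frobenius_norm_eq_L2_set L2_set_triangle_ineq)
qed

lemma frobenius_norm_minus_commute:
  assumes "A \<in> carrier_mat m n" "B \<in> carrier_mat m n"
  shows "frobenius_norm (A - B) = frobenius_norm (B - A)"
  using assms by (simp add: frobenius_norm_def power2_commute)

lemma frobenius_norm_transpose: "frobenius_norm (A\<^sup>T) = frobenius_norm A"
  unfolding frobenius_norm_def using sum.swap[of "\<lambda>i j. (A $$ (i, j))\<^sup>2"] by simp

lemma mat_mult_index_sum:
  assumes "A \<in> carrier_mat m k" "B \<in> carrier_mat k n" "i < m" "j < n"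
  shows "(A * B) $$ (i, j) = (\<Sum>l<k. A $$ (i, l) * B $$ (l, j))"
  using assms by (auto simp: scalar_prod_def lessThan_atLeast0 intro!: sum.cong)

text \<open>Cauchy-Schwarz bounds each squared entry of the product by a squared row norm of
  \<open>A\<close> times a squared column norm of \<open>B\<close>; the double sum of these bounds
  factors.\<close>

lemma frobenius_norm_mult:
  assumes "A \<in> carrier_mat m k" "B \<in> carrier_mat k n"
  shows "frobenius_norm (A * B) \<le> frobenius_norm A * frobenius_norm B"
proof -
  have "(frobenius_norm (A * B))\<^sup>2 = (\<Sum>i<m. \<Sum>j<n. (\<Sum>l<k. A $$ (i, l) * B $$ (l, j))\<^sup>2)"
    using assms by (subst frobenius_norm_power2[of _ m n])
      (auto simp: mat_mult_index_sum[OF assms] simp del: index_mult_mat intro!: sum.cong)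
  also have "\<dots> \<le> (\<Sum>i<m. \<Sum>j<n. (\<Sum>l<k. (A $$ (i, l))\<^sup>2) * (\<Sum>l<k. (B $$ (l, j))\<^sup>2))"
    by (intro sum_mono Cauchy_Schwarz_ineq_sum)
  also have "\<dots> = (\<Sum>i<m. \<Sum>l<k. (A $$ (i, l))\<^sup>2) * (\<Sum>j<n. \<Sum>l<k. (B $$ (l, j))\<^sup>2)"
    by (simp add: sum_product)
  also have "(\<Sum>j<n. \<Sum>l<k. (B $$ (l, j))\<^sup>2) = (\<Sum>l<k. \<Sum>j<n. (B $$ (l, j))\<^sup>2)"
    by (rule sum.swap)
  finally have "(frobenius_norm (A * B))\<^sup>2 \<le> (frobenius_norm A * frobenius_norm B)\<^sup>2"
    using assms by (simp add: frobenius_norm_power2 power_mult_distrib)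
  then show ?thesis by (rule power2_le_imp_le) simp
qed

lemma mat_trace_mult:
  assumes "A \<in> carrier_mat m n" "B \<in> carrier_mat n m"
  shows "mat_trace (A * B) = (\<Sum>i<m. \<Sum>j<n. A $$ (i, j) * B $$ (j, i))"
  using assms by (auto simp: mat_trace_def mat_mult_index_sum[OF assms] simp del: index_mult_mat(1))

lemma mat_trace_mult_comm:
  assumes "A \<in> carrier_mat m n" "B \<in> carrier_mat n m"
  shows "mat_trace (A * B) = mat_trace (B * A)"
  unfolding mat_trace_mult[OF assms] mat_trace_mult[OF assms(2,1)]
  by (subst sum.swap) (simp add: mult.commute)

lemma frobenius_norm_power2_trace:
  assumes "A \<in> carrier_mat m n"
  shows "(frobenius_norm A)\<^sup>2 = mat_trace (A * A\<^sup>T)"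
  unfolding frobenius_norm_power2[OF assms] using assms
  by (subst mat_trace_mult[of _ m n]) (auto simp: power2_eq_square intro!: sum.cong)

text \<open>The trace of \<open>A * B\<close> is the entrywise inner product of \<open>A\<close>
  with the transpose of \<open>B\<close>, so this is Cauchy-Schwarz.\<close>

lemma abs_mat_trace_mult_le:
  assumes "A \<in> carrier_mat m n" "B \<in> carrier_mat n m"
  shows "\<bar>mat_trace (A * B)\<bar> \<le> frobenius_norm A * frobenius_norm B"
proof -
  have "mat_trace (A * B) = (\<Sum>p\<in>{..<m} \<times> {..<n}. A $$ p * B\<^sup>T $$ p)"
    using assms by (auto simp: mat_trace_mult sum.cartesian_product intro!: sum.cong)
  also have "\<bar>\<dots>\<bar> \<le> (\<Sum>p\<in>{..<m} \<times> {..<n}. \<bar>A $$ p\<bar> * \<bar>B\<^sup>T $$ p\<bar>)"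
    by (rule order_trans[OF sum_abs]) (simp add: abs_mult)
  also have "\<dots> \<le> L2_set (\<lambda>p. A $$ p) ({..<m} \<times> {..<n}) * L2_set (\<lambda>p. B\<^sup>T $$ p) ({..<m} \<times> {..<n})"
    by (rule L2_set_mult_ineq)
  also have "\<dots> = frobenius_norm A * frobenius_norm (B\<^sup>T)"
    using assms by (simp add: frobenius_norm_eq_L2_set[of _ m n])
  finally show ?thesis by (simp add: frobenius_norm_transpose)
qed

text \<open>The point is that the right-hand side sees \<open>A\<close> only through its Frobenius
  norm and its trace, two quantities that agree for the two Gram matrices of a square
  matrix.\<close>

lemma frobenius_norm_minus_one_power2:
  assumes "A \<in> carrier_mat n n"
  shows "(frobenius_norm (A - 1\<^sub>m n))\<^sup>2 = (frobenius_norm A)\<^sup>2 - 2 * mat_trace A + real n"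
proof -
  have "((A - 1\<^sub>m n) $$ (i, j))\<^sup>2 = (A $$ (i, j))\<^sup>2 + (if j = i then 1 - 2 * A $$ (i, i) else 0)"
    if "i < n" "j < n" for i j
    using assms that by (simp add: power2_diff)
  then have "(frobenius_norm (A - 1\<^sub>m n))\<^sup>2
      = (\<Sum>i<n. \<Sum>j<n. (A $$ (i, j))\<^sup>2 + (if j = i then 1 - 2 * A $$ (i, i) else 0))"
    using assms by (subst frobenius_norm_power2[of _ n n]) (auto intro!: sum.cong)
  also have "\<dots> = (\<Sum>i<n. \<Sum>j<n. (A $$ (i, j))\<^sup>2) + (\<Sum>i<n. 1 - 2 * A $$ (i, i))"
    by (simp add: sum.distrib)
  finally show ?thesis
    using assms by (simp add: frobenius_norm_power2 mat_trace_def sum_subtractf sum_distrib_left)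
qed

text \<open>Cyclicity of the trace equates both the traces and the Frobenius norms of the two Gram
  matrices, so no eigenvalues are involved. This lets the lower bound for multiplication by
  \<open>R\<close> be expressed through R R^T - 1.\<close>

lemma frobenius_norm_gram_minus_one:
  assumes R: "R \<in> carrier_mat n n"
  shows "frobenius_norm (R\<^sup>T * R - 1\<^sub>m n) = frobenius_norm (R * R\<^sup>T - 1\<^sub>m n)"
proof -
  have "(frobenius_norm (R\<^sup>T * R))\<^sup>2 = mat_trace (R\<^sup>T * R * (R\<^sup>T * R))"
    using R by (subst frobenius_norm_power2_trace[of _ n n]) (auto simp: transpose_mult[of _ n n])
  also have "\<dots> = mat_trace (R\<^sup>T * (R * R\<^sup>T * R))"
    using R by (simp add: assoc_mult_mat[of _ n n _ n _ n])
  also have "\<dots> = mat_trace (R * R\<^sup>T * R * R\<^sup>T)"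
    using R by (intro mat_trace_mult_comm[of _ n n]) auto
  also have "\<dots> = mat_trace (R * R\<^sup>T * (R * R\<^sup>T))"
    using R by (simp add: assoc_mult_mat[of _ n n _ n _ n])
  also have "\<dots> = (frobenius_norm (R * R\<^sup>T))\<^sup>2"
    using R by (subst frobenius_norm_power2_trace[of _ n n]) (auto simp: transpose_mult[of _ n n])
  finally have "(frobenius_norm (R\<^sup>T * R))\<^sup>2 = (frobenius_norm (R * R\<^sup>T))\<^sup>2" .
  moreover have "mat_trace (R\<^sup>T * R) = mat_trace (R * R\<^sup>T)"
    using R by (intro mat_trace_mult_comm[of _ n n]) auto
  ultimately have "(frobenius_norm (R\<^sup>T * R - 1\<^sub>m n))\<^sup>2 = (frobenius_norm (R * R\<^sup>T - 1\<^sub>m n))\<^sup>2"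
    using R by (simp add: frobenius_norm_minus_one_power2)
  then show ?thesis by simp
qed

section \<open>Lower triangular matrices with positive diagonal\<close>

lemma lower_triangular_pos_mult:
  assumes A: "lower_triangular_pos n A" and B: "lower_triangular_pos n B"
  shows "lower_triangular_pos n (A * B)"
proof -
  have c: "A \<in> carrier_mat n n" "B \<in> carrier_mat n n"
    using A B by (auto simp: lower_triangular_pos_def)
  have "(A * B) $$ (i, j) = 0" if "i < n" "j < n" "i < j" for i j
  proof -
    have "A $$ (i, l) * B $$ (l, j) = 0" if "l < n" for l
      using A B \<open>i < n\<close> \<open>j < n\<close> \<open>i < j\<close> that unfolding lower_triangular_pos_def
      by (metis mult_eq_0_iff not_less_iff_gr_or_eq order_less_trans)
    then show ?thesis using that by (simp add: mat_mult_index_sum[OF c] sum.neutral del: index_mult_mat)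
  qed
  moreover have "(A * B) $$ (i, i) > 0" if "i < n" for i
  proof -
    have "A $$ (i, l) * B $$ (l, i) = (if l = i then A $$ (i, i) * B $$ (i, i) else 0)" if "l < n" for l
      using A B \<open>i < n\<close> that unfolding lower_triangular_pos_def
      by (metis mult_eq_0_iff not_less_iff_gr_or_eq)
    then have "(\<Sum>l<n. A $$ (i, l) * B $$ (l, i)) = (\<Sum>l<n. if l = i then A $$ (i, i) * B $$ (i, i) else 0)"
      by (intro sum.cong) simp_all
    then have "(A * B) $$ (i, i) = A $$ (i, i) * B $$ (i, i)"
      unfolding mat_mult_index_sum[OF c that that] using that by simp
    then show ?thesis using A B that by (simp add: lower_triangular_pos_def del: index_mult_mat)
  qed
  ultimately show ?thesis using c by (auto simp: lower_triangular_pos_def simp del: index_mult_mat(1))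
qed

text \<open>Forward substitution: once column j of \<open>B\<close> is known to vanish above row i,
  entry (i, j) of A B = 1 has only the term with the diagonal entry of \<open>A\<close>
  left.\<close>

lemma lower_triangular_pos_inverse:
  assumes A: "lower_triangular_pos n A" and B: "B \<in> carrier_mat n n" and AB: "A * B = 1\<^sub>m n"
  shows "lower_triangular_pos n B" and "i < n \<Longrightarrow> B $$ (i, i) = 1 / A $$ (i, i)"
proof -
  have c: "A \<in> carrier_mat n n" using A by (auto simp: lower_triangular_pos_def)
  have entry: "(\<Sum>l<n. A $$ (i, l) * B $$ (l, j)) = (if i = j then 1 else 0)" if "i < n" "j < n" for i j
    using mat_mult_index_sum[OF c B that] that by (simp add: AB)
  have pivot: "A $$ (i, i) * B $$ (i, j) = (if i = j then 1 else 0)"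
    if "i < n" "j < n" "\<And>l. l < i \<Longrightarrow> B $$ (l, j) = 0" for i j
  proof -
    have "A $$ (i, l) * B $$ (l, j) = (if l = i then A $$ (i, i) * B $$ (i, j) else 0)" if "l < n" for l
      using A \<open>i < n\<close> that \<open>\<And>l. l < i \<Longrightarrow> B $$ (l, j) = 0\<close> unfolding lower_triangular_pos_def
      by (metis mult_eq_0_iff not_less_iff_gr_or_eq)
    then have "(\<Sum>l<n. A $$ (i, l) * B $$ (l, j)) = (\<Sum>l<n. if l = i then A $$ (i, i) * B $$ (i, j) else 0)"
      by (intro sum.cong) simp_all
    also have "\<dots> = A $$ (i, i) * B $$ (i, j)" using that(1) by simp
    finally show ?thesis using entry[OF that(1,2)] by simp
  qed
  have nz: "A $$ (i, i) > 0" if "i < n" for i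
    using A that by (simp add: lower_triangular_pos_def)
  \<comment> \<open>Induction runs down the rows: all rows above i are strictly above the diagonal
    in column j as well, so \<open>pivot\<close> applies.\<close>
  have upper: "B $$ (i, j) = 0" if "i < j" "j < n" for i j
    using that
  proof (induction i rule: less_induct)
    case (less i)
    then show ?case using pivot[of i j] nz[of i] by force
  qed
  show diag: "B $$ (i, i) = 1 / A $$ (i, i)" if "i < n" for i
    using pivot[of i i] upper nz[of i] that by (simp add: field_simps)
  show "lower_triangular_pos n B"
    using B upper diag nz by (simp add: lower_triangular_pos_def)
qed

text \<open>\<open>B\<close> makes \<open>A\<close> a unit, so \<open>mat_inverse\<close> cannot
  return \<open>None\<close>; a returned right inverse C equals B A C = B.\<close>

lemma mat_inv_inverse:
  assumes A: "A \<in> carrier_mat n n" and "B \<in> carrier_mat n n" "A * B = 1\<^sub>m n" "B * A = 1\<^sub>m n"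
  shows "mat_inv A = B"
proof (cases "mat_inverse A")
  case None
  then show ?thesis using mat_inverse(1)[OF A None] assms by (auto simp: Units_def ring_mat_def)
next
  case (Some C)
  then have C: "A * C = 1\<^sub>m n" "C \<in> carrier_mat n n" using mat_inverse(2)[OF A Some] by auto
  have "B * A * C = B * (A * C)" using C assms by (intro assoc_mult_mat) auto
  then show ?thesis using C assms Some by (simp add: mat_inv_def)
qed

text \<open>The determinant is the product of the diagonal entries, none of which is zero.\<close>

lemma lower_triangular_pos_invertible:
  assumes A: "lower_triangular_pos n A"
  obtains B where "B \<in> carrier_mat n n" "A * B = 1\<^sub>m n" "B * A = 1\<^sub>m n"
proof -
  have c: "A \<in> carrier_mat n n" using A by (auto simp: lower_triangular_pos_def)
  have "det A = prod_list (diag_mat A)"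
    using A by (intro det_lower_triangular[OF _ c]) (auto simp: lower_triangular_pos_def)
  moreover have "0 \<notin> set (diag_mat A)"
    using A by (force simp: diag_mat_def lower_triangular_pos_def)
  ultimately have "det A \<noteq> 0" by (simp add: prod_list_zero_iff)
  then show ?thesis using det_non_zero_imp_unit[OF c] that by (auto simp: Units_def ring_mat_def)
qed

section \<open>Cholesky factors of matrices close to the identity\<close>

text \<open>With R^T R = 1 + F, the square of the norm of R X is that of X plus the trace of X^T F
  X, and this trace is at most the norm of F times the squared norm of X. Finally F has the same
  norm as R R^T - 1.\<close>

lemma frobenius_norm_mult_ge:
  assumes R: "R \<in> carrier_mat n n" and X: "X \<in> carrier_mat n n"
  shows "(1 - frobenius_norm (R * R\<^sup>T - 1\<^sub>m n)) * (frobenius_norm X)\<^sup>2 \<le> (frobenius_norm (R * X))\<^sup>2"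
proof -
  define F where "F = R\<^sup>T * R - 1\<^sub>m n"
  have F: "F \<in> carrier_mat n n" using R by (auto simp: F_def)
  have RR: "R\<^sup>T * R = 1\<^sub>m n + F" using R by (intro eq_matI) (auto simp: F_def)
  have "(frobenius_norm (R * X))\<^sup>2 = mat_trace (R * X * (R * X)\<^sup>T)"
    using R X by (intro frobenius_norm_power2_trace[of _ n n]) auto
  also have "\<dots> = mat_trace ((R * X)\<^sup>T * (R * X))"
    using R X by (intro mat_trace_mult_comm[of _ n n]) auto
  also have "(R * X)\<^sup>T * (R * X) = X\<^sup>T * (R\<^sup>T * R * X)"
    using R X by (simp add: transpose_mult[of _ n n] assoc_mult_mat[of _ n n _ n _ n])
  also have "\<dots> = X\<^sup>T * X + X\<^sup>T * (F * X)"
    using F X unfolding RR by (simp add: add_mult_distrib_mat[of _ n n] mult_add_distrib_mat[of _ n n])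
  also have "mat_trace \<dots> = mat_trace (X\<^sup>T * X) + mat_trace (X\<^sup>T * (F * X))"
    using R X by (simp add: mat_trace_def sum.distrib del: index_mult_mat(1))
  also have "mat_trace (X\<^sup>T * X) = (frobenius_norm X)\<^sup>2"
    using X mat_trace_mult_comm[of X n n "X\<^sup>T"] by (simp add: frobenius_norm_power2_trace)
  finally have eq: "(frobenius_norm (R * X))\<^sup>2 = (frobenius_norm X)\<^sup>2 + mat_trace (X\<^sup>T * (F * X))" .
  have "\<bar>mat_trace (X\<^sup>T * (F * X))\<bar> \<le> frobenius_norm (X\<^sup>T) * frobenius_norm (F * X)"
    using F X by (intro abs_mat_trace_mult_le[of _ n n]) auto
  also have "\<dots> \<le> frobenius_norm X * (frobenius_norm F * frobenius_norm X)"
    unfolding frobenius_norm_transpose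
    by (intro mult_left_mono frobenius_norm_mult[OF F X]) auto
  finally show ?thesis
    using eq frobenius_norm_gram_minus_one[OF R] by (simp add: F_def algebra_simps power2_eq_square)
qed

text \<open>The entries of \<open>G\<close> at (i, j) and (j, i) have a nonnegative product: off the
  diagonal one of them is zero, on it they coincide. Hence dropping the cross terms of the squares
  leaves every squared entry of \<open>G\<close> counted twice.\<close>

lemma frobenius_norm_lower_symmetrize:
  assumes G: "G \<in> carrier_mat n n" and low: "\<And>i j. i < j \<Longrightarrow> j < n \<Longrightarrow> G $$ (i, j) = 0"
  shows "sqrt 2 * frobenius_norm G \<le> frobenius_norm (G + G\<^sup>T)"
proof -
  have "2 * (frobenius_norm G)\<^sup>2
      = (\<Sum>i<n. \<Sum>j<n. (G $$ (i, j))\<^sup>2) + (\<Sum>j<n. \<Sum>i<n. (G $$ (i, j))\<^sup>2)"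
    using sum.swap[of "\<lambda>i j. (G $$ (i, j))\<^sup>2" "{..<n}" "{..<n}"]
    by (simp add: frobenius_norm_power2[OF G])
  also have "\<dots> = (\<Sum>i<n. \<Sum>j<n. (G $$ (i, j))\<^sup>2 + (G $$ (j, i))\<^sup>2)"
    by (simp add: sum.distrib)
  also have "\<dots> \<le> (\<Sum>i<n. \<Sum>j<n. (G $$ (i, j) + G $$ (j, i))\<^sup>2)"
  proof (intro sum_mono)
    fix i j assume "i \<in> {..<n}" "j \<in> {..<n}"
    then have "0 \<le> G $$ (i, j) * G $$ (j, i)"
      using low[of i j] low[of j i] by (cases i j rule: linorder_cases) auto
    then show "(G $$ (i, j))\<^sup>2 + (G $$ (j, i))\<^sup>2 \<le> (G $$ (i, j) + G $$ (j, i))\<^sup>2"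
      by (simp add: power2_sum)
  qed
  also have "\<dots> = (frobenius_norm (G + G\<^sup>T))\<^sup>2"
    using G by (subst frobenius_norm_power2[of _ n n]) auto
  finally have "(sqrt 2 * frobenius_norm G)\<^sup>2 \<le> (frobenius_norm (G + G\<^sup>T))\<^sup>2"
    by (simp add: power_mult_distrib)
  then show ?thesis by (rule power2_le_imp_le) simp
qed

text \<open>Two rounds: a crude bound on \<open>G\<close>, with the constant sqrt (5/4) instead of
  1, comes from the inverse of \<open>R\<close>; inserted into the quadratic term of G + G^T = E - G
  G^T it sharpens the constant to 1.\<close>

lemma cholesky_factor_near_identity:
  assumes R: "lower_triangular_pos n R" and small: "frobenius_norm (R * R\<^sup>T - 1\<^sub>m n) \<le> 1 / 5"
  shows "frobenius_norm (R - 1\<^sub>m n) \<le> frobenius_norm (R * R\<^sup>T - 1\<^sub>m n)"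
proof -
  have c: "R \<in> carrier_mat n n" using R by (auto simp: lower_triangular_pos_def)
  obtain B where B: "B \<in> carrier_mat n n" "R * B = 1\<^sub>m n"
    using lower_triangular_pos_invertible[OF R] by auto
  define e where "e = frobenius_norm (R * R\<^sup>T - 1\<^sub>m n)"
  define G where "G = R - 1\<^sub>m n"
  define X where "X = R\<^sup>T - B"
  have G: "G \<in> carrier_mat n n" and X: "X \<in> carrier_mat n n" using c B by (auto simp: G_def X_def)
  have e: "0 \<le> e" "e \<le> 1 / 5" using small by (auto simp: e_def)
  have low: "G $$ (i, j) = 0" if "i < j" "j < n" for i j
    using R c that by (simp add: G_def lower_triangular_pos_def)
  have "R * X = R * R\<^sup>T - 1\<^sub>m n"
    unfolding X_def using c B by (simp add: mult_minus_distrib_mat[of _ n n])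
  then have Xle: "(1 - e) * (frobenius_norm X)\<^sup>2 \<le> e\<^sup>2"
    using frobenius_norm_mult_ge[OF c X] by (simp add: e_def)
  \<comment> \<open>Strictly below the diagonal the inverse contributes nothing to the transposed
    position, so both sides agree; above it \<open>G\<close> vanishes. Only the diagonal needs a
    computation.\<close>
  have ent: "\<bar>G $$ (i, j)\<bar> \<le> \<bar>X $$ (j, i)\<bar>" if "i < n" "j < n" for i j
  proof (cases i j rule: linorder_cases)
    case less
    then show ?thesis using low that by simp
  next
    case greater
    then have "B $$ (j, i) = 0"
      using lower_triangular_pos_inverse(1)[OF R B] that by (simp add: lower_triangular_pos_def)
    then show ?thesis using greater c B that by (simp add: G_def X_def)
  next
    case equal
    define r where "r = R $$ (i, i)"
    have "r > 0" using R that by (simp add: r_def lower_triangular_pos_def)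
    then have "r - 1 / r = (r - 1) * ((r + 1) / r)" by (simp add: field_simps)
    moreover have "1 \<le> (r + 1) / r" using \<open>r > 0\<close> by simp
    ultimately have "\<bar>r - 1\<bar> \<le> \<bar>r - 1 / r\<bar>"
      using mult_left_mono[of 1 "(r + 1) / r" "\<bar>r - 1\<bar>"] \<open>r > 0\<close> by (simp add: abs_mult)
    then show ?thesis
      using lower_triangular_pos_inverse(2)[OF R B] equal c B that by (simp add: G_def X_def r_def)
  qed
  have "(frobenius_norm G)\<^sup>2 \<le> (frobenius_norm (X\<^sup>T))\<^sup>2"
    using X ent by (auto simp: frobenius_norm_power2[OF G] frobenius_norm_power2[of "X\<^sup>T" n n]
        abs_le_square_iff intro!: sum_mono)
  then have "(1 - e) * (frobenius_norm G)\<^sup>2 \<le> (1 - e) * (frobenius_norm X)\<^sup>2"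
    unfolding frobenius_norm_transpose using e by (intro mult_left_mono) auto
  \<comment> \<open>4/5 is the least value of 1 - e for e up to 1/5; its reciprocal is the 5/4
    below.\<close>
  moreover have "(4 / 5) * (frobenius_norm G)\<^sup>2 \<le> (1 - e) * (frobenius_norm G)\<^sup>2"
    using e by (intro mult_right_mono) auto
  ultimately have G2: "(frobenius_norm G)\<^sup>2 \<le> 5 / 4 * e\<^sup>2" using Xle by simp
  have "R * R\<^sup>T - 1\<^sub>m n = G + G\<^sup>T + G * G\<^sup>T"
  proof -
    have RG: "R = 1\<^sub>m n + G" using c by (auto simp: G_def)
    have "R * R\<^sup>T = (1\<^sub>m n + G) * (1\<^sub>m n + G\<^sup>T)" 
      using G unfolding RG by (simp add: transpose_add[of _ n n])
    also have "\<dots> = 1\<^sub>m n + G + (G\<^sup>T + G * G\<^sup>T)"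
      using G by (simp add: add_mult_distrib_mat[of _ n n _ _ n] mult_add_distrib_mat[of _ n n _ n])
    finally show ?thesis using G by (auto intro!: eq_matI simp del: index_mult_mat(1))
  qed
  then have "G + G\<^sup>T = (R * R\<^sup>T - 1\<^sub>m n) + (- (G * G\<^sup>T))"
    using G by (auto intro!: eq_matI simp del: index_mult_mat(1))
  then have "frobenius_norm (G + G\<^sup>T) \<le> e + frobenius_norm (- (G * G\<^sup>T))"
    using G frobenius_norm_triangle[OF minus_carrier_mat[OF one_carrier_mat], of "- (G * G\<^sup>T)"]
    by (simp add: e_def)
  also have "frobenius_norm (- (G * G\<^sup>T)) = frobenius_norm (G * G\<^sup>T)"
    by (simp add: frobenius_norm_def del: index_mult_mat(1))
  also have "\<dots> \<le> (frobenius_norm G)\<^sup>2"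
    using frobenius_norm_mult[of G n n "G\<^sup>T" n] G by (simp add: frobenius_norm_transpose power2_eq_square)
  finally have "sqrt 2 * frobenius_norm G \<le> e + 5 / 4 * e\<^sup>2"
    using frobenius_norm_lower_symmetrize[OF G low] G2 by linarith
  \<comment> \<open>As e is at most 1/5, the quadratic term is at most e/4. The next step then only
    needs 25/16 \<le> 2, which is where the factor sqrt 2 gained from symmetrization is
    spent.\<close>
  also have "\<dots> \<le> 5 / 4 * e"
    using mult_left_mono[of e "1 / 5" e] e by (simp add: power2_eq_square)
  also have "\<dots> \<le> sqrt 2 * e"
    using e by (intro mult_right_mono real_le_rsqrt) (auto simp: power2_eq_square)
  finally show ?thesis by (simp add: G_def e_def)
qed

section \<open>Euclidean and spectral norms\<close>

lemma euclid_norm_power2: "(euclid_norm v)\<^sup>2 = (\<Sum>i<dim_vec v. (v $ i)\<^sup>2)"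
  by (simp add: euclid_norm_def scalar_prod_def lessThan_atLeast0 sum_nonneg flip: power2_eq_square)

lemma euclid_norm_power2_scalar_prod: "(euclid_norm v)\<^sup>2 = scalar_prod v v"
  by (simp add: euclid_norm_power2 scalar_prod_def lessThan_atLeast0 flip: power2_eq_square)

lemma euclid_norm_eq_L2_set: "euclid_norm v = L2_set (\<lambda>i. v $ i) {..<dim_vec v}"
  by (simp add: euclid_norm_def L2_set_def scalar_prod_def lessThan_atLeast0 power2_eq_square)

lemma euclid_norm_nonneg [simp]: "0 \<le> euclid_norm v"
  by (simp add: euclid_norm_eq_L2_set)

lemma euclid_norm_smult: "euclid_norm (c \<cdot>\<^sub>v v) = \<bar>c\<bar> * euclid_norm v"
  unfolding euclid_norm_def by (simp add: real_sqrt_mult flip: mult.assoc)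

lemma scalar_prod_le_euclid_norm:
  assumes "dim_vec v = dim_vec w"
  shows "scalar_prod v w \<le> euclid_norm v * euclid_norm w"
proof -
  have "scalar_prod v w \<le> (\<Sum>i<dim_vec w. \<bar>v $ i\<bar> * \<bar>w $ i\<bar>)"
    by (auto simp: scalar_prod_def lessThan_atLeast0 abs_le_iff simp flip: abs_mult intro!: sum_mono)
  also have "\<dots> \<le> euclid_norm v * euclid_norm w"
    unfolding euclid_norm_eq_L2_set assms by (rule L2_set_mult_ineq)
  finally show ?thesis .
qed

lemma frobenius_norm_power2_cols:
  "A \<in> carrier_mat m n \<Longrightarrow> (frobenius_norm A)\<^sup>2 = (\<Sum>j<n. (euclid_norm (col A j))\<^sup>2)"
  by (simp add: frobenius_norm_power2 euclid_norm_power2 sum.swap[of _ "{..<m}"])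

lemma euclid_norm_mult_mat_vec_le_frobenius:
  assumes A: "A \<in> carrier_mat m n" and v: "v \<in> carrier_vec n"
  shows "euclid_norm (A *\<^sub>v v) \<le> frobenius_norm A * euclid_norm v"
proof -
  have "(euclid_norm (A *\<^sub>v v))\<^sup>2 = (\<Sum>i<m. (\<Sum>j<n. A $$ (i, j) * v $ j)\<^sup>2)"
    using A v by (auto simp: euclid_norm_power2 scalar_prod_def lessThan_atLeast0 intro!: sum.cong)
  also have "\<dots> \<le> (\<Sum>i<m. (\<Sum>j<n. (A $$ (i, j))\<^sup>2) * (\<Sum>j<n. (v $ j)\<^sup>2))"
    by (intro sum_mono Cauchy_Schwarz_ineq_sum)
  also have "\<dots> = (frobenius_norm A * euclid_norm v)\<^sup>2"
    using A v by (simp add: power_mult_distrib frobenius_norm_power2 euclid_norm_power2 sum_distrib_right)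
  finally show ?thesis by (rule power2_le_imp_le) simp
qed

text \<open>Normalize v and compare with the supremum, which is bounded because the Frobenius norm
  is an upper bound. A vector of norm zero is treated separately, which also covers dimension 0,
  where the supremum is over the empty set.\<close>

lemma euclid_norm_mult_mat_vec_le_spectral:
  assumes A: "A \<in> carrier_mat m n" and v: "v \<in> carrier_vec n"
  shows "euclid_norm (A *\<^sub>v v) \<le> spectral_norm A * euclid_norm v"
proof (cases "euclid_norm v = 0")
  case True
  then show ?thesis using euclid_norm_mult_mat_vec_le_frobenius[OF A v] by simp
next
  case False
  let ?V = "{v \<in> carrier_vec (dim_col A). euclid_norm v = 1}"
  define w where "w = (1 / euclid_norm v) \<cdot>\<^sub>v v"
  have pos: "0 < euclid_norm v" using False by (simp add: less_le)
  have "w \<in> ?V" using A v False by (simp add: w_def euclid_norm_smult)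
  moreover have "bdd_above ((\<lambda>v. euclid_norm (A *\<^sub>v v)) ` ?V)"
  proof (rule bdd_aboveI2)
    show "euclid_norm (A *\<^sub>v x) \<le> frobenius_norm A" if "x \<in> ?V" for x
      using euclid_norm_mult_mat_vec_le_frobenius[OF A, of x] A that by simp
  qed
  ultimately have "euclid_norm (A *\<^sub>v w) \<le> spectral_norm A"
    unfolding spectral_norm_def by (rule cSUP_upper)
  moreover have "A *\<^sub>v w = (1 / euclid_norm v) \<cdot>\<^sub>v (A *\<^sub>v v)"
    using A v by (simp add: w_def mult_mat_vec)
  ultimately show ?thesis
    using pos by (simp add: euclid_norm_smult field_simps)
qed

text \<open>For a single column v, the squared norm of B v is the inner product of B^T B v with v;
  the matrix case sums over columns. Taken with B = L^-1, the Gram matrix is the inverse of M, so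
  the norm of that inverse appears directly.\<close>

lemma frobenius_norm_mult_le_spectral_gram:
  assumes B: "B \<in> carrier_mat m n" and A: "A \<in> carrier_mat n k"
  shows "(frobenius_norm (B * A))\<^sup>2 \<le> spectral_norm (B\<^sup>T * B) * (frobenius_norm A)\<^sup>2"
proof -
  have vec: "(euclid_norm (B *\<^sub>v v))\<^sup>2 \<le> spectral_norm (B\<^sup>T * B) * (euclid_norm v)\<^sup>2"
    if v: "v \<in> carrier_vec n" for v
  proof -
    have "(euclid_norm (B *\<^sub>v v))\<^sup>2 = scalar_prod (B *\<^sub>v v) (B *\<^sub>v v)"
      by (rule euclid_norm_power2_scalar_prod)
    also have "\<dots> = scalar_prod (B\<^sup>T *\<^sub>v (B *\<^sub>v v)) v"
      using B v by (intro transpose_vec_mult_scalar[OF B v, symmetric]) auto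
    also have "B\<^sup>T *\<^sub>v (B *\<^sub>v v) = B\<^sup>T * B *\<^sub>v v"
      using B v by (simp add: assoc_mult_mat_vec[of _ n m _ n])
    also have "scalar_prod (B\<^sup>T * B *\<^sub>v v) v \<le> euclid_norm (B\<^sup>T * B *\<^sub>v v) * euclid_norm v"
      using B v by (intro scalar_prod_le_euclid_norm) auto
    also have "\<dots> \<le> spectral_norm (B\<^sup>T * B) * euclid_norm v * euclid_norm v"
      using B v by (intro mult_right_mono euclid_norm_mult_mat_vec_le_spectral[of _ n n]) auto
    finally show ?thesis by (simp add: power2_eq_square)
  qed
  have "(frobenius_norm (B * A))\<^sup>2 = (\<Sum>j<k. (euclid_norm (B *\<^sub>v col A j))\<^sup>2)"
    using A B by (subst frobenius_norm_power2_cols[of _ m k]) (auto simp: mult_mat_vec_def)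
  also have "\<dots> \<le> (\<Sum>j<k. spectral_norm (B\<^sup>T * B) * (euclid_norm (col A j))\<^sup>2)"
    using A by (intro sum_mono vec) auto
  finally show ?thesis using A by (simp add: frobenius_norm_power2_cols sum_distrib_left)
qed

text \<open>A unit vector picks out the column of the nonzero entry. Needed to cancel the norm of M
  in the relative error.\<close>

lemma spectral_norm_pos:
  assumes A: "A \<in> carrier_mat m n" and "i < m" "j < n" "A $$ (i, j) \<noteq> 0"
  shows "spectral_norm A > 0"
proof -
  have "A *\<^sub>v unit_vec n j = col A j"
    using assms by (intro eq_vecI) auto
  then have le: "euclid_norm (col A j) \<le> spectral_norm A * euclid_norm (unit_vec n j)"
    using euclid_norm_mult_mat_vec_le_spectral[OF A, of "unit_vec n j"] by simp
  have "0 < (A $$ (i, j))\<^sup>2" using assms by simp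
  also have "\<dots> \<le> (\<Sum>i<m. (col A j $ i)\<^sup>2)"
    using assms member_le_sum[of i "{..<m}" "\<lambda>i. (col A j $ i)\<^sup>2"] by simp
  also have "\<dots> = (euclid_norm (col A j))\<^sup>2"
    using assms by (simp add: euclid_norm_power2)
  finally have "0 < euclid_norm (col A j)" by (simp add: less_le)
  also note le
  finally show ?thesis by (rule zero_less_mult_pos2) (use assms in \<open>simp add: euclid_norm_def\<close>)
qed

section \<open>Perturbation of Cholesky factors and of snapshot families\<close>

lemma cholesky_perturbation:
  assumes L: "lower_triangular_pos n L" and K: "lower_triangular_pos n K"
    and \<epsilon>: "\<epsilon> = spectral_norm (mat_inv (L * L\<^sup>T)) * frobenius_norm (L * L\<^sup>T - K * K\<^sup>T)"
    and small: "\<epsilon> \<le> 1 / 5"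
  shows "frobenius_norm (L - K) \<le> \<epsilon> * frobenius_norm L"
proof -
  have c: "L \<in> carrier_mat n n" "K \<in> carrier_mat n n"
    using L K by (auto simp: lower_triangular_pos_def)
  obtain B where B: "B \<in> carrier_mat n n" "L * B = 1\<^sub>m n" "B * L = 1\<^sub>m n"
    using lower_triangular_pos_invertible[OF L] by auto
  note assoc = assoc_mult_mat[of _ n n _ n _ n]
  have BT: "B\<^sup>T * L\<^sup>T = 1\<^sub>m n" "L\<^sup>T * B\<^sup>T = 1\<^sub>m n"
    by (metis B(2,3) transpose_mult[OF c(1) B(1)] transpose_mult[OF B(1) c(1)] transpose_one)+
  \<comment> \<open>\<open>assoc\<close> nests products to the right, so an inverse pair has to
    cancel in front of a tail Z.\<close>
  have canc: "L * (B * Z) = Z" "B * (L * Z) = Z" "B\<^sup>T * (L\<^sup>T * Z) = Z" "L\<^sup>T * (B\<^sup>T * Z) = Z"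
    if "Z \<in> carrier_mat n n" for Z
    using B c BT that by (simp_all flip: assoc)
  have inv: "mat_inv (L * L\<^sup>T) = B\<^sup>T * B"
    using B c BT canc by (intro mat_inv_inverse[of _ n]) (simp_all add: assoc)
  define R where "R = B * K"
  define D where "D = K * K\<^sup>T - L * L\<^sup>T"
  define s where "s = spectral_norm (B\<^sup>T * B)"
  have R: "lower_triangular_pos n R" "R \<in> carrier_mat n n"
    unfolding R_def using lower_triangular_pos_mult lower_triangular_pos_inverse(1)[OF L B(1,2)] K B c
    by auto
  have D: "D \<in> carrier_mat n n" using c by (auto simp: D_def)
  have DT: "D\<^sup>T = D"
    using c by (simp add: D_def transpose_minus[of _ n n] transpose_mult[of _ n n])
  have LR: "L * R = K" using canc c by (simp add: R_def)
  \<comment> \<open>Writing 1 as B L L^T B^T turns the difference into a congruence of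
    \<open>D\<close>.\<close>
  have E: "R * R\<^sup>T - 1\<^sub>m n = B * (D * B\<^sup>T)"
    unfolding R_def D_def using B BT c canc
    by (simp add: transpose_mult[of _ n n] assoc minus_mult_distrib_mat[of _ n n _ _ n]
        mult_minus_distrib_mat[of _ n n _ n])
  \<comment> \<open>For n = 0 the spectral norm is a supremum over the empty set, whose sign is
    unknown; there the Frobenius norms vanish instead.\<close>
  have s: "0 \<le> s" if "0 < n"
  proof -
    have "0 \<le> euclid_norm (B\<^sup>T * B *\<^sub>v unit_vec n 0)" by simp
    also have "\<dots> \<le> s * euclid_norm (unit_vec n 0)"
      unfolding s_def using B by (intro euclid_norm_mult_mat_vec_le_spectral[of _ n n]) auto
    finally show ?thesis using that by (simp add: euclid_norm_def)
  qed
  have \<epsilon>_eq: "\<epsilon> = s * frobenius_norm D"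
    using c by (simp add: \<epsilon> inv s_def D_def frobenius_norm_minus_commute[of "L * L\<^sup>T" n n])
  have \<epsilon>_nonneg: "0 \<le> \<epsilon>"
  proof (cases "n = 0")
    case True
    then show ?thesis using D by (simp add: \<epsilon>_eq frobenius_norm_def)
  next
    case False
    then show ?thesis using s by (simp add: \<epsilon>_eq)
  qed
  have "(frobenius_norm (B * (D * B\<^sup>T)))\<^sup>2 \<le> s * (frobenius_norm (D * B\<^sup>T))\<^sup>2"
    unfolding s_def using B D by (intro frobenius_norm_mult_le_spectral_gram[of _ n n]) auto
  \<comment> \<open>Since \<open>D\<close> is symmetric, transposing moves the second factor to the
    left, where the Gram bound applies again. Each use costs one factor \<open>s\<close>, hence the
    square of \<open>\<epsilon>\<close>.\<close>
  also have "frobenius_norm (D * B\<^sup>T) = frobenius_norm (B * D)"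
    using frobenius_norm_transpose[of "D * B\<^sup>T"] B D DT by (simp add: transpose_mult[of _ n n])
  also have "s * (frobenius_norm (B * D))\<^sup>2 \<le> s * (s * (frobenius_norm D)\<^sup>2)"
  proof (cases "n = 0")
    case True
    then show ?thesis using B D by (simp add: frobenius_norm_def)
  next
    case False
    then show ?thesis
      using s frobenius_norm_mult_le_spectral_gram[OF B(1) D] unfolding s_def
      by (intro mult_left_mono) auto
  qed
  also have "s * (s * (frobenius_norm D)\<^sup>2) = \<epsilon>\<^sup>2"
    by (simp add: \<epsilon>_eq power_mult_distrib power2_eq_square)
  finally have "(frobenius_norm (R * R\<^sup>T - 1\<^sub>m n))\<^sup>2 \<le> \<epsilon>\<^sup>2" by (simp only: E)
  then have "frobenius_norm (R * R\<^sup>T - 1\<^sub>m n) \<le> \<epsilon>"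
    using \<epsilon>_nonneg by (rule power2_le_imp_le)
  then have RE: "frobenius_norm (R - 1\<^sub>m n) \<le> \<epsilon>"
    using cholesky_factor_near_identity[OF R(1)] small by linarith
  have "L * (R - 1\<^sub>m n) = K - L"
    using c R LR by (simp add: mult_minus_distrib_mat[of _ n n])
  then have "frobenius_norm (L - K) \<le> frobenius_norm L * frobenius_norm (R - 1\<^sub>m n)"
    using c frobenius_norm_mult[OF c(1) minus_carrier_mat[OF one_carrier_mat], of R]
      frobenius_norm_minus_commute[of L n n K] by simp
  also have "\<dots> \<le> frobenius_norm L * \<epsilon>"
    using RE by (rule mult_left_mono) simp
  finally show ?thesis by (simp add: mult.commute)
qed

lemma mult_gram_transpose:
  fixes A V W :: "real mat"
  assumes A: "A \<in> carrier_mat m n" and V: "V \<in> carrier_mat n p" and W: "W \<in> carrier_mat p p"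
  shows "A * V * W * (A * V)\<^sup>T = A * (V * W * V\<^sup>T) * A\<^sup>T"
  using assms
  by (simp add: transpose_mult[OF A V] assoc_mult_mat[of _ m n _ p _ p] assoc_mult_mat[of _ m n _ p _ m]
      assoc_mult_mat[of _ n p _ p _ m] assoc_mult_mat[of _ n p _ p _ n] assoc_mult_mat[of _ m n _ n _ m]
      assoc_mult_mat[of _ n p _ n _ m] assoc_mult_mat[of _ p p _ n _ m])

text \<open>The stacked norm of A V depends on V only through its Gram matrix C C^T, so V may be
  replaced by C with weight 1. This trades the weighted grid functions for triangular
  factors.\<close>

lemma stacked_norm_mult:
  assumes V: "V \<in> carrier_mat n p" and W: "W \<in> carrier_mat p p" and A: "A \<in> carrier_mat m n"
    and C: "C \<in> carrier_mat n n" and eq: "V * W * V\<^sup>T = C * C\<^sup>T"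
  shows "stacked_norm W (A * V) = frobenius_norm (A * C)"
proof -
  have "A * V * W * (A * V)\<^sup>T = A * (C * 1\<^sub>m n * C\<^sup>T) * A\<^sup>T"
    using C mult_gram_transpose[OF A V W] by (simp add: eq)
  also have "\<dots> = A * C * (A * C)\<^sup>T"
    using A C mult_gram_transpose[OF A C one_carrier_mat] by simp
  finally have "stacked_norm W (A * V) = sqrt ((frobenius_norm (A * C))\<^sup>2)"
    using A C by (simp add: stacked_norm_def frobenius_norm_power2_trace[of _ m n])
  then show ?thesis by simp
qed

lemma stacked_norm_data_generated_le:
  fixes n p :: nat
  assumes n: "0 < n"
    and U: "U \<in> carrier_mat n p" and U\<^sub>0: "U\<^sub>0 \<in> carrier_mat n p" and W: "W \<in> carrier_mat p p"
    and M: "M = U * W * U\<^sup>T" and L: "cholesky M L" and L\<^sub>0: "cholesky (U\<^sub>0 * W * U\<^sub>0\<^sup>T) L\<^sub>0"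
    and adm: "admissible U\<^sub>0 V"
    and \<epsilon>: "\<epsilon> = cond_number M * (frobenius_norm (M - V * W * V\<^sup>T) / spectral_norm M)"
    and small: "\<epsilon> \<le> 1 / 5"
  shows "stacked_norm W (L * mat_inv L\<^sub>0 * U\<^sub>0 - V) \<le> \<epsilon> * stacked_norm W U"
proof -
  have low: "lower_triangular_pos n L" "lower_triangular_pos n L\<^sub>0"
    and LL: "M = L * L\<^sup>T" and LL\<^sub>0: "U\<^sub>0 * W * U\<^sub>0\<^sup>T = L\<^sub>0 * L\<^sub>0\<^sup>T"
    using L L\<^sub>0 M U U\<^sub>0 by (auto simp: cholesky_def)
  obtain S where S: "lower_triangular_pos n S" and V: "V = S * U\<^sub>0"
    using adm U\<^sub>0 by (auto simp: admissible_def)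
  have c: "L \<in> carrier_mat n n" "L\<^sub>0 \<in> carrier_mat n n" "S \<in> carrier_mat n n"
    using low S by (auto simp: lower_triangular_pos_def)
  obtain B where B: "B \<in> carrier_mat n n" "L\<^sub>0 * B = 1\<^sub>m n" "B * L\<^sub>0 = 1\<^sub>m n"
    using lower_triangular_pos_invertible[OF low(2)] by auto
  note inv = mat_inv_inverse[OF c(2) B]
  define K where "K = S * L\<^sub>0"
  have K: "lower_triangular_pos n K"
    unfolding K_def by (rule lower_triangular_pos_mult[OF S low(2)])
  have "V * W * V\<^sup>T = S * (L\<^sub>0 * 1\<^sub>m n * L\<^sub>0\<^sup>T) * S\<^sup>T"
    using c mult_gram_transpose[OF c(3) U\<^sub>0 W] by (simp add: V LL\<^sub>0)
  also have "\<dots> = K * K\<^sup>T"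
    using c mult_gram_transpose[OF c(3,2) one_carrier_mat] by (simp add: K_def)
  finally have VK: "V * W * V\<^sup>T = K * K\<^sup>T" .
  \<comment> \<open>The first diagonal entry of M is a sum of squares containing that of
    \<open>L $$ (0, 0)\<close>; hence M is nonzero, and its spectral norm cancels between
    \<open>cond_number\<close> and the relative error.\<close>
  have "L $$ (0, 0) > 0" using low n by (simp add: lower_triangular_pos_def)
  moreover have "M $$ (0, 0) = (\<Sum>l<n. (L $$ (0, l))\<^sup>2)"
    unfolding LL using mat_mult_index_sum[of L n n "L\<^sup>T" n 0 0] c n by (simp add: power2_eq_square)
  moreover have "(L $$ (0, 0))\<^sup>2 \<le> (\<Sum>l<n. (L $$ (0, l))\<^sup>2)"
    using n by (intro member_le_sum) auto
  ultimately have "M $$ (0, 0) \<noteq> 0" by (smt (verit) zero_less_power2)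
  then have "spectral_norm M \<noteq> 0"
    using spectral_norm_pos[of M n n 0 0] n c LL by auto
  then have \<epsilon>': "\<epsilon> = spectral_norm (mat_inv (L * L\<^sup>T)) * frobenius_norm (L * L\<^sup>T - K * K\<^sup>T)"
    unfolding \<epsilon> cond_number_def VK LL by simp
  \<comment> \<open>Both families are multiples of \<open>U\<^sub>0\<close>, hence so is their
    difference, and its coefficient matrix times \<open>L\<^sub>0\<close> is L - K.\<close>
  have "L * B * U\<^sub>0 - V = (L * B - S) * U\<^sub>0"
    unfolding V using c B U\<^sub>0 by (simp add: minus_mult_distrib_mat[of _ n n])
  then have "stacked_norm W (L * mat_inv L\<^sub>0 * U\<^sub>0 - V) = frobenius_norm ((L * B - S) * L\<^sub>0)"
    unfolding inv using c B stacked_norm_mult[OF U\<^sub>0 W minus_carrier_mat[OF c(3)] c(2) LL\<^sub>0] by simp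
  also have "(L * B - S) * L\<^sub>0 = L - K"
    using c B by (simp add: K_def minus_mult_distrib_mat[of _ n n] assoc_mult_mat[of _ _ n])
  also have "frobenius_norm (L - K) \<le> \<epsilon> * frobenius_norm L"
    using low(1) K \<epsilon>' small by (rule cholesky_perturbation)
  also have "frobenius_norm L = stacked_norm W U"
    using stacked_norm_mult[OF U W one_carrier_mat c(1)] U c(1) M LL by simp
  finally show ?thesis .
qed

theorem proposition2:
  assumes "DIM('a::euclidean_space) = 1 \<or> DIM('a) = 2"
  shows "\<exists>\<delta>>0. \<forall>(\<Omega> :: 'a set) (T :: real) (q :: 'a \<Rightarrow> real) (g :: nat \<Rightarrow> 'a \<Rightarrow> real)
      (u :: nat \<Rightarrow> real \<Rightarrow> 'a \<Rightarrow> real) (u\<^sub>0 :: nat \<Rightarrow> real \<Rightarrow> 'a \<Rightarrow> real)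
      (n\<^sub>t :: nat) (n\<^sub>b :: nat) (\<tau> :: real) (P :: nat) (\<xi> :: nat \<Rightarrow> 'a) (w :: nat \<Rightarrow> real)
      (U :: real mat) (U\<^sub>0 :: real mat) (W :: real mat) (M :: real mat) (M\<^sub>0 :: real mat)
      (L :: real mat) (L\<^sub>0 :: real mat) (Udg :: real mat) (Uhat :: real mat) (Mhat :: real mat)
      (\<epsilon>' :: real).
      open \<Omega> \<longrightarrow> connected \<Omega> \<longrightarrow> bounded \<Omega> \<longrightarrow> \<Omega> \<noteq> {} \<longrightarrow> T > 0 \<longrightarrow>
      (\<forall>m\<in>{1..n\<^sub>b}. plasma_wave_solution \<Omega> T q (g m) (u m)) \<longrightarrow>
      (\<forall>m\<in>{1..n\<^sub>b}. plasma_wave_solution \<Omega> T (\<lambda>x. 0) (g m) (u\<^sub>0 m)) \<longrightarrow>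
      n\<^sub>t \<ge> 1 \<longrightarrow> n\<^sub>b \<ge> 1 \<longrightarrow> \<tau> > 0 \<longrightarrow> (\<forall>j<n\<^sub>t. real j * \<tau> \<le> T) \<longrightarrow>
      inj_on \<xi> {..<P} \<longrightarrow> \<xi> ` {..<P} \<subseteq> closure \<Omega> \<longrightarrow> (\<forall>k<P. w k > 0) \<longrightarrow>
      U = snapshot_matrix n\<^sub>t n\<^sub>b \<tau> P \<xi> u \<longrightarrow>
      U\<^sub>0 = snapshot_matrix n\<^sub>t n\<^sub>b \<tau> P \<xi> u\<^sub>0 \<longrightarrow>
      W = mat_diag P w \<longrightarrow>
      rows_lin_indpt U \<longrightarrow> rows_lin_indpt U\<^sub>0 \<longrightarrow>
      M = U * W * U\<^sup>T \<longrightarrow> M\<^sub>0 = U\<^sub>0 * W * U\<^sub>0\<^sup>T \<longrightarrow>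
      cholesky M L \<longrightarrow> cholesky M\<^sub>0 L\<^sub>0 \<longrightarrow>
      Udg = L * mat_inv L\<^sub>0 * U\<^sub>0 \<longrightarrow>
      best_admissible W U\<^sub>0 U Uhat \<longrightarrow>
      Mhat = Uhat * W * Uhat\<^sup>T \<longrightarrow>
      \<epsilon>' = cond_number M * (frobenius_norm (M - Mhat) / spectral_norm M) \<longrightarrow>
      \<epsilon>' \<le> \<delta> \<longrightarrow>
      stacked_norm W (Udg - Uhat) \<le> \<epsilon>' * stacked_norm W U"
proof (rule exI[of _ "1 / 5"], intro conjI allI impI)
  fix \<Omega> :: "'a set" and T q and g :: "nat \<Rightarrow> 'a \<Rightarrow> real"
    and u u\<^sub>0 :: "nat \<Rightarrow> real \<Rightarrow> 'a \<Rightarrow> real" and n\<^sub>t n\<^sub>b \<tau> P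
    and \<xi> :: "nat \<Rightarrow> 'a" and w U U\<^sub>0 W M M\<^sub>0 L L\<^sub>0 Udg Uhat Mhat \<epsilon>'
  assume "n\<^sub>t \<ge> 1" "n\<^sub>b \<ge> 1"
    and U: "U = snapshot_matrix n\<^sub>t n\<^sub>b \<tau> P \<xi> u" "U\<^sub>0 = snapshot_matrix n\<^sub>t n\<^sub>b \<tau> P \<xi> u\<^sub>0" "W = mat_diag P w"
    and M: "M = U * W * U\<^sup>T" "M\<^sub>0 = U\<^sub>0 * W * U\<^sub>0\<^sup>T" and L: "cholesky M L" "cholesky M\<^sub>0 L\<^sub>0"
    and Udg: "Udg = L * mat_inv L\<^sub>0 * U\<^sub>0" and best: "best_admissible W U\<^sub>0 U Uhat"
    and Mhat: "Mhat = Uhat * W * Uhat\<^sup>T"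
    and \<epsilon>': "\<epsilon>' = cond_number M * (frobenius_norm (M - Mhat) / spectral_norm M)" "\<epsilon>' \<le> 1 / 5"
  show "stacked_norm W (Udg - Uhat) \<le> \<epsilon>' * stacked_norm W U"
    unfolding Udg
  proof (rule stacked_norm_data_generated_le)
    \<comment> \<open>At least one snapshot is what makes M nonzero.\<close>
    show "0 < n\<^sub>t * n\<^sub>b" using \<open>n\<^sub>t \<ge> 1\<close> \<open>n\<^sub>b \<ge> 1\<close> by simp
    show "U \<in> carrier_mat (n\<^sub>t * n\<^sub>b) P" "U\<^sub>0 \<in> carrier_mat (n\<^sub>t * n\<^sub>b) P"
      by (auto simp: U snapshot_matrix_def)
    show "W \<in> carrier_mat P P" by (simp add: U)
    show "admissible U\<^sub>0 Uhat" using best by (simp add: best_admissible_def)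
    show "M = U * W * U\<^sup>T" "cholesky M L" by (fact M(1) L(1))+
    show "cholesky (U\<^sub>0 * W * U\<^sub>0\<^sup>T) L\<^sub>0" using L(2) unfolding M(2) .
    show "\<epsilon>' = cond_number M * (frobenius_norm (M - Uhat * W * Uhat\<^sup>T) / spectral_norm M)"
      using \<epsilon>'(1) unfolding Mhat .
  qed (fact \<epsilon>'(2))
qed simp

end
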